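(* Let $A$ be a nilpotent algebra over a field $\mathbb{F}$, and let $\circ$ be the operation $a\circ b=a+b+f(a,b)$ on $A$, where $f(x,y)$ is a nonassociative polynomial over $\mathbb{F}$ in $x,y$ all of whose monomials have degree $\ge2$. If $f(x,y)$ has no monomials depending on one variable only, then $A$ with the operation $\circ$ is a loop, with neutral element $0$.
   Context: An algebra over $\mathbb{F}$ is a vector space with a bilinear multiplication, not assumed associative, Lie, commutative or unital. $A$ is nilpotent of class $\le c$ if every product (with any bracketing) of $c+1$ elements of $A$ is zero. The polynomial $f$ is an element of the absolutely free nonassociative (non-unital) algebra on $x,y$ over $\mathbb{F}$ (no coefficients from $A$). A quasigroup is a set with a binary operation $\circ$ such that the equations $a\circ y=c$ and $x\circ b=c$ have unique solutions for all $a,b,c$; a loop is a quasigroup with a two-sided neutral element. *)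

theory Defs
  imports Complex_Main "HOL-Library.Poly_Mapping"
begin

locale nonassoc_algebra = vector_space scale
  for scale :: "'k::field \<Rightarrow> 'a::ab_group_add \<Rightarrow> 'a" +
  fixes mult :: "'a \<Rightarrow> 'a \<Rightarrow> 'a"
  assumes linear_mult_left: "Vector_Spaces.linear scale scale (\<lambda>x. mult x y)"
    and linear_mult_right: "Vector_Spaces.linear scale scale (\<lambda>y. mult x y)"

text \<open>
  Fully bracketed non-empty words, i.e. the free magma. The set function
  \<open>mon_vars\<close> collects the letters that occur in a word.
\<close>

datatype (mon_vars: 'v) na_monomial =
  Var 'v
| Prod "'v na_monomial" "'v na_monomial"

primrec mon_degree :: "'v na_monomial \<Rightarrow> nat" where
  "mon_degree (Var v) = 1"
| "mon_degree (Prod s t) = mon_degree s + mon_degree t"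

primrec mon_eval :: "('a \<Rightarrow> 'a \<Rightarrow> 'a) \<Rightarrow> ('v \<Rightarrow> 'a) \<Rightarrow> 'v na_monomial \<Rightarrow> 'a" where
  "mon_eval mult \<rho> (Var v) = \<rho> v"
| "mon_eval mult \<rho> (Prod s t) = mult (mon_eval mult \<rho> s) (mon_eval mult \<rho> t)"

text \<open>
  A product of \<open>n\<close> elements of an algebra with some bracketing is the value of a
  word of degree \<open>n\<close> whose letters are the elements themselves.
\<close>

definition nilpotent_class_le :: "('a::zero \<Rightarrow> 'a \<Rightarrow> 'a) \<Rightarrow> nat \<Rightarrow> bool" where
  "nilpotent_class_le mult c \<longleftrightarrow>
     (\<forall>t :: 'a na_monomial. mon_degree t = c + 1 \<longrightarrow> mon_eval mult (\<lambda>a. a) t = 0)"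

definition nilpotent :: "('a::zero \<Rightarrow> 'a \<Rightarrow> 'a) \<Rightarrow> bool" where
  "nilpotent mult \<longleftrightarrow> (\<exists>c. nilpotent_class_le mult c)"

datatype xy = X | Y

text \<open>
  The underlying space of the absolutely free non-unital algebra on \<open>X\<close>, \<open>Y\<close>: finitely
  supported coefficient functions on the free magma. Since there is no empty word, there
  are no constant terms. The monomials of \<open>f\<close> are the elements of \<open>Poly_Mapping.keys f\<close>.
\<close>

type_synonym 'k na_poly = "xy na_monomial \<Rightarrow>\<^sub>0 'k"

definition poly_eval ::
    "('k::zero \<Rightarrow> 'a::comm_monoid_add \<Rightarrow> 'a) \<Rightarrow> ('a \<Rightarrow> 'a \<Rightarrow> 'a) \<Rightarrow> 'k na_poly \<Rightarrow> 'a \<Rightarrow> 'a \<Rightarrow> 'a"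
  where
  "poly_eval scale mult f a b =
     (\<Sum>m\<in>Poly_Mapping.keys f. scale (Poly_Mapping.lookup f m) (mon_eval mult (case_xy a b) m))"

definition quasigroup :: "('a \<Rightarrow> 'a \<Rightarrow> 'a) \<Rightarrow> bool" where
  "quasigroup op \<longleftrightarrow> (\<forall>a c. \<exists>!y. op a y = c) \<and> (\<forall>b c. \<exists>!x. op x b = c)"

definition neutral_element :: "('a \<Rightarrow> 'a \<Rightarrow> 'a) \<Rightarrow> 'a \<Rightarrow> bool" where
  "neutral_element op e \<longleftrightarrow> (\<forall>a. op e a = a \<and> op a e = a)"

definition loop :: "('a \<Rightarrow> 'a \<Rightarrow> 'a) \<Rightarrow> bool" where
  "loop op \<longleftrightarrow> quasigroup op \<and> (\<exists>e. neutral_element op e)"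

end

theory Submission
  imports Defs
begin

text \<open>
  Let \<open>A\<^sup>n\<close> be the span of all products of \<open>n\<close> elements. These subspaces decrease from
  \<open>A\<close> to \<open>0\<close>, and multiplying by an element of \<open>A\<close> maps \<open>A\<^sup>n\<close> into \<open>A\<^sup>n\<^sup>+\<^sup>1\<close>. As \<open>f\<close> has no
  linear terms, \<open>y \<mapsto> c - a - f(a, y)\<close> is a contraction: it maps elements congruent
  modulo \<open>A\<^sup>n\<close> to elements congruent modulo \<open>A\<^sup>n\<^sup>+\<^sup>1\<close>. Hence it has exactly one fixed point,
  which is the solution of \<open>a \<circ> y = c\<close>; the other division is symmetric. Every monomial of \<open>f\<close>
  contains both variables, so \<open>f\<close> vanishes when one argument is \<open>0\<close>.
\<close>

lemma mon_degree_pos: "mon_degree t > 0"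
  by (induction t) auto

lemma mon_vars_nonempty: "mon_vars t \<noteq> {}"
  by (induction t) auto

text \<open>A product of two letters inside the word is itself an element, hence can be made one letter.\<close>

lemma mon_eval_shorten:
  assumes "mon_degree t = Suc (Suc n)"
  shows "\<exists>t'. mon_degree t' = Suc n \<and> mon_eval mult (\<lambda>a. a) t' = mon_eval mult (\<lambda>a. a) t"
  using assms
proof (induction t arbitrary: n)
  case (Var v)
  then show ?case by simp
next
  case (Prod s t)
  show ?case
  proof (cases "mon_degree s = 1 \<and> mon_degree t = 1")
    case True
    then show ?thesis
      using Prod.prems by (intro exI[of _ "Var (mon_eval mult (\<lambda>a. a) (Prod s t))"]) simp
  next
    case False
    then consider k where "mon_degree s = Suc (Suc k)" | k where "mon_degree t = Suc (Suc k)"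
      using mon_degree_pos[of s] mon_degree_pos[of t]
      by (metis One_nat_def gr0_implies_Suc not_gr_zero)
    then show ?thesis
    proof cases
      case 1
      then obtain s' where "mon_degree s' = Suc k"
          "mon_eval mult (\<lambda>a. a) s' = mon_eval mult (\<lambda>a. a) s"
        using Prod.IH(1) by blast
      then show ?thesis
        using 1 Prod.prems by (intro exI[of _ "Prod s' t"]) simp
    next
      case 2
      then obtain t' where "mon_degree t' = Suc k"
          "mon_eval mult (\<lambda>a. a) t' = mon_eval mult (\<lambda>a. a) t"
        using Prod.IH(2) by blast
      then show ?thesis
        using 2 Prod.prems by (intro exI[of _ "Prod s t'"]) simp
    qed
  qed
qed

text \<open>Banach's argument for a filtration that reaches 0: the iterates of \<phi> become
  stationary after \<open>c\<close> steps, and two fixed points differ by an element of every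
  \<open>S n\<close>.\<close>

lemma unique_fixpoint_of_contraction:
  fixes S :: "nat \<Rightarrow> 'a::ab_group_add set"
  assumes top: "S 0 = UNIV" and bot: "S c = {0}"
    and contr: "\<And>n x y. x - y \<in> S n \<Longrightarrow> \<phi> x - \<phi> y \<in> S (Suc n)"
  shows "\<exists>!x. \<phi> x = x"
proof (rule ex_ex1I)
  \<comment> \<open>Consecutive iterates. The starting point 0 is arbitrary, since
    \<open>S 0\<close> is everything.\<close>
  have "(\<phi> ^^ n) (\<phi> 0) - (\<phi> ^^ n) 0 \<in> S n" for n
    by (induction n) (auto simp: top contr)
  from this[of c] have "\<phi> ((\<phi> ^^ c) 0) = (\<phi> ^^ c) 0"
    by (simp add: bot funpow_swap1)
  then show "\<exists>x. \<phi> x = x" ..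
next
  fix x y
  assume fp: "\<phi> x = x" "\<phi> y = y"
  have "x - y \<in> S n" for n
    by (induction n) (use contr[of x y] in \<open>auto simp: top fp\<close>)
  from this[of c] show "x = y"
    by (simp add: bot)
qed

context nonassoc_algebra
begin

lemma mult_simps:
  "mult 0 y = 0" "mult x 0 = 0"
  "mult (x + x') y = mult x y + mult x' y" "mult x (y + y') = mult x y + mult x y'"
  "mult (x - x') y = mult x y - mult x' y" "mult x (y - y') = mult x y - mult x y'"
  "mult (scale r x) y = scale r (mult x y)" "mult x (scale r y) = scale r (mult x y)"
proof -
  interpret l: Vector_Spaces.linear scale scale "\<lambda>x. mult x y" for y
    by (rule linear_mult_left)
  interpret r: Vector_Spaces.linear scale scale "\<lambda>y. mult x y" for x
    by (rule linear_mult_right)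
  show "mult 0 y = 0" "mult x 0 = 0"
    "mult (x + x') y = mult x y + mult x' y" "mult x (y + y') = mult x y + mult x y'"
    "mult (x - x') y = mult x y - mult x' y" "mult x (y - y') = mult x y - mult x y'"
    "mult (scale r x) y = scale r (mult x y)" "mult x (scale r y) = scale r (mult x y)"
    by (simp_all add: l.zero r.zero l.add r.add l.diff r.diff l.scale r.scale)
qed

text \<open>Indexed so that \<open>alg_power n\<close> is \<open>A\<^sup>n\<^sup>+\<^sup>1\<close>.\<close>

definition alg_power :: "nat \<Rightarrow> 'a set" where
  "alg_power n = span {mon_eval mult (\<lambda>a. a) t |t. mon_degree t = Suc n}"

lemma subspace_alg_power: "subspace (alg_power n)"
  by (simp add: alg_power_def)

lemma mon_eval_in_alg_power:
  "mon_degree t = Suc n \<Longrightarrow> mon_eval mult (\<lambda>a. a) t \<in> alg_power n"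
  unfolding alg_power_def by (rule span_base) blast

lemma alg_power_0: "alg_power 0 = UNIV"
  using mon_eval_in_alg_power[of "Var x" 0 for x] by auto

lemma alg_power_eq_0:
  assumes "nilpotent_class_le mult c"
  shows "alg_power c = {0}"
proof -
  have "{mon_eval mult (\<lambda>a. a) t |t. mon_degree t = Suc c} \<subseteq> {0}"
    using assms by (auto simp: nilpotent_class_le_def)
  then have "alg_power c \<subseteq> {0}"
    unfolding alg_power_def by (rule span_minimal) (rule subspace_single_0)
  then show ?thesis
    using subspace_0[OF subspace_alg_power] by blast
qed

text \<open>The generating sets are already nested, by \<open>mon_eval_shorten\<close>.\<close>

lemma alg_power_Suc_subset: "alg_power (Suc n) \<subseteq> alg_power n"
proof -
  have "{mon_eval mult (\<lambda>a. a) t |t. mon_degree t = Suc (Suc n)}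
      \<subseteq> {mon_eval mult (\<lambda>a. a) t |t. mon_degree t = Suc n}"
  proof
    fix x
    assume "x \<in> {mon_eval mult (\<lambda>a. a) t |t. mon_degree t = Suc (Suc n)}"
    then obtain t where "x = mon_eval mult (\<lambda>a. a) t" "mon_degree t = Suc (Suc n)"
      by blast
    moreover obtain t' where "mon_degree t' = Suc n"
        "mon_eval mult (\<lambda>a. a) t' = mon_eval mult (\<lambda>a. a) t"
      using mon_eval_shorten[OF calculation(2)] by blast
    ultimately show "x \<in> {mon_eval mult (\<lambda>a. a) t |t. mon_degree t = Suc n}"
      by (intro CollectI exI[of _ t']) simp
  qed
  then show ?thesis
    unfolding alg_power_def by (rule span_mono)
qed

text \<open>By bilinearity only generators matter. There \<open>y\<close> itself serves as one
  further letter, which raises the degree of the word by one.\<close>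

lemma mult_in_alg_power:
  assumes "x \<in> alg_power n"
  shows "mult x y \<in> alg_power (Suc n)" "mult y x \<in> alg_power (Suc n)"
proof -
  let ?P = "\<lambda>x. mult x y \<in> alg_power (Suc n) \<and> mult y x \<in> alg_power (Suc n)"
  have "?P x"
    using assms[unfolded alg_power_def]
  proof (rule span_induct)
    show "subspace (Collect ?P)"
      using subspace_alg_power[of "Suc n"]
      by (simp add: subspace_def mult_simps)
  next
    fix z
    assume "z \<in> {mon_eval mult (\<lambda>a. a) t |t. mon_degree t = Suc n}"
    then obtain t where "z = mon_eval mult (\<lambda>a. a) t" "mon_degree t = Suc n"
      by blast
    then show "?P z"
      using mon_eval_in_alg_power[of "Prod t (Var y)" "Suc n"]
        mon_eval_in_alg_power[of "Prod (Var y) t" "Suc n"] by simp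
  qed
  then show "mult x y \<in> alg_power (Suc n)" "mult y x \<in> alg_power (Suc n)"
    by simp_all
qed

lemma mult_diff_in_alg_power:
  assumes "s - s' \<in> alg_power n" "t - t' \<in> alg_power n"
  shows "mult s t - mult s' t' \<in> alg_power (Suc n)"
proof -
  \<comment> \<open>Change one factor at a time, so that each summand has a factor in
    \<open>alg_power n\<close>.\<close>
  have "mult s t - mult s' t' = mult (s - s') t + mult s' (t - t')"
    by (simp add: mult_simps)
  then show ?thesis
    using assms by (simp add: mult_in_alg_power subspace_add[OF subspace_alg_power])
qed

text \<open>A single letter gains no level, so for arbitrary words the level gained at a product is
  given up again.\<close>

lemma mon_eval_diff_in_alg_power:
  assumes "\<And>v. \<rho> v - \<rho>' v \<in> alg_power n"
  shows "mon_eval mult \<rho> m - mon_eval mult \<rho>' m \<in> alg_power n"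
proof (induction m)
  case (Var v)
  then show ?case using assms by simp
next
  case (Prod s t)
  then show ?case
    using mult_diff_in_alg_power alg_power_Suc_subset by fastforce
qed

text \<open>Degree at least 2 forces an outermost product, and this product gains the level; its
  factors may be single letters.\<close>

lemma mon_eval_diff_in_alg_power_Suc:
  assumes "\<And>v. \<rho> v - \<rho>' v \<in> alg_power n" "mon_degree m \<ge> 2"
  shows "mon_eval mult \<rho> m - mon_eval mult \<rho>' m \<in> alg_power (Suc n)"
  using assms(2)
  by (cases m) (simp_all add: mult_diff_in_alg_power mon_eval_diff_in_alg_power assms(1))

lemma poly_eval_diff_in_alg_power_Suc:
  assumes "a - a' \<in> alg_power n" "b - b' \<in> alg_power n"
    and "\<And>m. m \<in> Poly_Mapping.keys f \<Longrightarrow> mon_degree m \<ge> 2"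
  shows "poly_eval scale mult f a b - poly_eval scale mult f a' b' \<in> alg_power (Suc n)"
proof -
  have "case_xy a b v - case_xy a' b' v \<in> alg_power n" for v
    using assms(1,2) by (cases v) auto
  then show ?thesis
    unfolding poly_eval_def sum_subtractf[symmetric] scale_right_diff_distrib[symmetric]
    by (intro subspace_sum subspace_scale subspace_alg_power
        mon_eval_diff_in_alg_power_Suc assms(3))
qed

lemma mon_eval_eq_0:
  assumes "v \<in> mon_vars m" "\<rho> v = 0"
  shows "mon_eval mult \<rho> m = 0"
  using assms by (induction m) (auto simp: mult_simps)

lemma poly_eval_zero:
  assumes "\<And>m v. m \<in> Poly_Mapping.keys f \<Longrightarrow> mon_vars m \<noteq> {v}"
  shows "poly_eval scale mult f 0 a = 0" "poly_eval scale mult f a 0 = 0"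
proof -
  \<comment> \<open>The set of letters is a nonempty subset of a two-element type and not a
    singleton.\<close>
  have "X \<in> mon_vars m \<and> Y \<in> mon_vars m" if m: "m \<in> Poly_Mapping.keys f" for m
  proof -
    obtain v where v: "v \<in> mon_vars m"
      using mon_vars_nonempty[of m] by blast
    then obtain w where "w \<in> mon_vars m" "w \<noteq> v"
      using assms[OF m, of v] by blast
    with v show ?thesis
      by (metis xy.exhaust)
  qed
  then show "poly_eval scale mult f 0 a = 0" "poly_eval scale mult f a 0 = 0"
    unfolding poly_eval_def
    by (auto intro!: sum.neutral simp: mon_eval_eq_0[where v = X] mon_eval_eq_0[where v = Y])
qed

lemma quasigroup_add_poly_eval:
  assumes "nilpotent mult"
    and deg: "\<And>m. m \<in> Poly_Mapping.keys f \<Longrightarrow> mon_degree m \<ge> 2"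
  shows "quasigroup (\<lambda>a b. a + b + poly_eval scale mult f a b)"
proof -
  let ?f = "poly_eval scale mult f"
  obtain k where "nilpotent_class_le mult k"
    using assms(1) by (auto simp: nilpotent_def)
  then have bot: "alg_power k = {0}"
    by (rule alg_power_eq_0)
  \<comment> \<open>Needed for the argument that is held fixed: its difference \<open>a - a\<close>
    must lie in every level.\<close>
  have zero: "0 \<in> alg_power n" for n
    by (rule subspace_0[OF subspace_alg_power])
  \<comment> \<open>Stated for any \<open>g\<close> that gains a level, to serve both divisions:
    \<open>g\<close> will be \<open>?f\<close> with its first or its second argument fixed.\<close>
  have uniq: "\<exists>!x. d - g x = x"
    if g: "\<And>n x y. x - y \<in> alg_power n \<Longrightarrow> g x - g y \<in> alg_power (Suc n)" for d and g
  proof (rule unique_fixpoint_of_contraction[where S = alg_power, OF alg_power_0 bot])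
    fix n x y
    assume "x - y \<in> alg_power n"
    then have "- (g x - g y) \<in> alg_power (Suc n)"
      by (intro subspace_neg subspace_alg_power g)
    then show "d - g x - (d - g y) \<in> alg_power (Suc n)"
      by (simp add: algebra_simps)
  qed
  have "\<exists>!y. a + y + ?f a y = c" for a c
  proof -
    have "(c - a) - ?f a y = y \<longleftrightarrow> a + y + ?f a y = c" for y
      by (auto simp: algebra_simps)
    moreover have "\<exists>!y. (c - a) - ?f a y = y"
      by (rule uniq) (simp add: poly_eval_diff_in_alg_power_Suc zero deg)
    ultimately show ?thesis by simp
  qed
  moreover have "\<exists>!x. x + b + ?f x b = c" for b c
  proof -
    have "(c - b) - ?f x b = x \<longleftrightarrow> x + b + ?f x b = c" for x
      by (auto simp: algebra_simps)
    moreover have "\<exists>!x. (c - b) - ?f x b = x"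
      by (rule uniq) (simp add: poly_eval_diff_in_alg_power_Suc zero deg)
    ultimately show ?thesis by simp
  qed
  ultimately show ?thesis
    by (simp add: quasigroup_def)
qed

end

theorem proposition1p7:
  fixes scale :: "'k::field \<Rightarrow> 'a::ab_group_add \<Rightarrow> 'a"
    and mult :: "'a \<Rightarrow> 'a \<Rightarrow> 'a"
    and f :: "'k na_poly"
    and circ :: "'a \<Rightarrow> 'a \<Rightarrow> 'a"
  assumes "nonassoc_algebra scale mult"
    and "nilpotent mult"
    and "\<And>m. m \<in> Poly_Mapping.keys f \<Longrightarrow> mon_degree m \<ge> 2"
    and "\<And>a b. circ a b = a + b + poly_eval scale mult f a b"
    and "\<And>m v. m \<in> Poly_Mapping.keys f \<Longrightarrow> mon_vars m \<noteq> {v}"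
  shows "loop circ \<and> neutral_element circ 0"
proof -
  interpret nonassoc_algebra scale mult
    by (rule assms(1))
  have "circ = (\<lambda>a b. a + b + poly_eval scale mult f a b)"
    by (intro ext assms(4))
  then have "quasigroup circ"
    using quasigroup_add_poly_eval[OF assms(2,3)] by simp
  moreover have "neutral_element circ 0"
    by (simp add: neutral_element_def assms(4) poly_eval_zero[OF assms(5)])
  ultimately show ?thesis
    by (auto simp: loop_def)
qed

end
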